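(* Let $S$ be a semigroup. For $i=1,2$ let $a_i,b_i,c_i\in S$ and suppose that $a_i$ is $(b_i,c_i)$-invertible with $(b_i,c_i)$-inverse $x_i\in S$. Then for any $y\in S^1$: (i) $ya_1x_1=a_2x_2y$ if and only if $ya_1b_1\in a_2b_2S$ and $c_2y\in Sc_1$. (ii) $yx_1a_1=x_2a_2y$ if and only if $yb_1\in b_2S$ and $c_2a_2y\in Sc_1a_1$. (iii) $ya_1x_1=x_2a_2y$ if and only if $ya_1b_1\in b_2S$ and $c_2a_2y\in Sc_1$. (iv) $yx_1a_1=a_2x_2y$ if and only if $yb_1\in a_2b_2S$ and $c_2y\in Sc_1a_1$.
   Context: For $a,b,c\in S$, an element $x\in S$ is a $(b,c)$-inverse of $a$ if $xab=b$, $cax=c$, $x\in bSx$, and $x\in xSc$ (equivalently $xab=b$, $cax=c$, $x\in bS$, $x\in Sc$); such $x$ is unique when it exists, and $a$ is then called $(b,c)$-invertible. Here $uS=\{us:s\in S\}$ and $Su=\{su:s\in S\}$. $S^1$ denotes the monoid equal to $S$ if $S$ has an identity element and to $S\cup\{1\}$ (with an identity $1$ adjoined) otherwise. *)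

theory Defs
  imports Main
begin

definition is_identity :: "'a::semigroup_mult \<Rightarrow> bool" where
  "is_identity e \<longleftrightarrow> (\<forall>s. e * s = s \<and> s * e = s)"

(* The monoid S^1: Some s is the element s of S, and None is the adjoined identity,
   which is present only if S has no identity of its own. *)
typedef (overloaded) 'a monoid1 =
  "if \<exists>e::'a::semigroup_mult. is_identity e then range (Some :: 'a \<Rightarrow> 'a option) else UNIV"
  by auto

definition emb :: "'a::semigroup_mult \<Rightarrow> 'a monoid1" where
  "emb s = Abs_monoid1 (Some s)"

fun mult_opt :: "'a::semigroup_mult option \<Rightarrow> 'a option \<Rightarrow> 'a option" where
  "mult_opt None v = v"
| "mult_opt u None = u"
| "mult_opt (Some s) (Some t) = Some (s * t)"

lemma mult_opt_None_right: "mult_opt u None = u"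
  by (cases u) auto

lemma mult_opt_assoc: "mult_opt (mult_opt u v) w = mult_opt u (mult_opt v w)"
  by (cases u; cases v; cases w) (auto simp: mult.assoc)

lemma Rep_monoid1_mult_opt:
  "Rep_monoid1 (Abs_monoid1 (mult_opt (Rep_monoid1 x) (Rep_monoid1 y)))
     = mult_opt (Rep_monoid1 x) (Rep_monoid1 y)"
  using Rep_monoid1[of x] Rep_monoid1[of y]
  by (intro Abs_monoid1_inverse) (auto split: if_splits)

lemma Rep_emb: "Rep_monoid1 (emb s) = Some s"
  unfolding emb_def by (intro Abs_monoid1_inverse) auto

instantiation monoid1 :: (semigroup_mult) monoid_mult
begin

definition one_monoid1 :: "'a monoid1" where
  "1 = (if \<exists>e::'a. is_identity e then emb (THE e. is_identity e) else Abs_monoid1 None)"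

definition times_monoid1 :: "'a monoid1 \<Rightarrow> 'a monoid1 \<Rightarrow> 'a monoid1" where
  "x * y = Abs_monoid1 (mult_opt (Rep_monoid1 x) (Rep_monoid1 y))"

instance
proof
  fix x y z :: "'a monoid1"
  show "x * y * z = x * (y * z)"
    by (simp add: times_monoid1_def Rep_monoid1_mult_opt mult_opt_assoc)
  have "1 * x = x \<and> x * 1 = x"
  proof (cases "\<exists>e::'a. is_identity e")
    case True
    then obtain e :: 'a where e: "is_identity e" by blast
    have "(THE e::'a. is_identity e) = e"
    proof (rule the_equality)
      fix f :: 'a assume "is_identity f"
      with e show "f = e" by (metis is_identity_def)
    qed (rule e)
    then have one: "Rep_monoid1 (1 :: 'a monoid1) = Some e"
      using True by (simp add: one_monoid1_def Rep_emb)
    obtain s where s: "Rep_monoid1 x = Some s"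
      using Rep_monoid1[of x] True by auto
    have "mult_opt (Some e) (Some s) = Some s" "mult_opt (Some s) (Some e) = Some s"
      using e by (auto simp: is_identity_def)
    then show ?thesis
      using one s Rep_monoid1_inverse[of x] by (simp add: times_monoid1_def)
  next
    case False
    then have "Rep_monoid1 (1 :: 'a monoid1) = None"
      by (simp add: one_monoid1_def Abs_monoid1_inverse)
    then show ?thesis
      by (simp add: times_monoid1_def mult_opt_None_right Rep_monoid1_inverse)
  qed
  then show "1 * x = x" and "x * 1 = x" by auto
qed

end

lemma emb_mult: "emb (s * t) = emb s * emb t"
  by (simp add: times_monoid1_def Rep_emb) (simp add: emb_def)

lemma inj_emb: "inj emb"
  by (metis Rep_emb injI option.inject)

lemma range_emb:
  "range (emb :: 'a::semigroup_mult \<Rightarrow> 'a monoid1) =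
     (if \<exists>e::'a. is_identity e then UNIV else UNIV - {1})"
proof -
  have *: "x \<in> range emb \<longleftrightarrow> Rep_monoid1 x \<noteq> None" for x :: "'a monoid1"
  proof
    assume "Rep_monoid1 x \<noteq> None"
    then obtain s where "Rep_monoid1 x = Some s" by auto
    then have "x = emb s" by (metis Rep_monoid1_inverse emb_def)
    then show "x \<in> range emb" by simp
  qed (auto simp: Rep_emb)
  show ?thesis
  proof (cases "\<exists>e::'a. is_identity e")
    case True
    have "Rep_monoid1 x \<noteq> None" for x :: "'a monoid1"
      using Rep_monoid1[of x] True by auto
    with * True show ?thesis by auto
  next
    case False
    have "Rep_monoid1 x = None \<longleftrightarrow> x = 1" for x :: "'a monoid1"
      using False Rep_monoid1_inverse[of x] by (auto simp: one_monoid1_def Abs_monoid1_inverse)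
    with * False show ?thesis by auto
  qed
qed

definition right_mults :: "'a::semigroup_mult \<Rightarrow> 'a set" where
  "right_mults u = {u * s | s. True}"

definition left_mults :: "'a::semigroup_mult \<Rightarrow> 'a set" where
  "left_mults u = {s * u | s. True}"

definition is_bc_inverse :: "'a::semigroup_mult \<Rightarrow> 'a \<Rightarrow> 'a \<Rightarrow> 'a \<Rightarrow> bool" where
  "is_bc_inverse a b c x \<longleftrightarrow>
     x * a * b = b \<and> c * a * x = c \<and>
     x \<in> {b * s * x | s. True} \<and> x \<in> {x * s * c | s. True}"

end

theory Submission
  imports Defs
begin

text \<open>
  If \<open>x\<close> is the \<open>(b,c)\<close>-inverse of \<open>a\<close>, then \<open>a x\<close> and \<open>x a\<close> are idempotents, and each of
  them is recognised by the principal one-sided ideals it generates: \<open>a x\<close> generates the right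
  ideal of \<open>a b\<close> and the left ideal of \<open>c\<close>, while \<open>x a\<close> generates the right ideal of \<open>b\<close> and the
  left ideal of \<open>c a\<close> (lemmas \<open>ideal_idempotent_mult_inverse\<close> and
  \<open>ideal_idempotent_inverse_mult\<close>).

  The four claims are therefore instances of a single one, \<open>intertwines_iff\<close>. Let \<open>p\<close> and \<open>q\<close> be
  idempotents with right generators \<open>b\<close>, \<open>b'\<close> and left generators \<open>c\<close>, \<open>c'\<close>. Then \<open>y p = q y\<close>
  splits into \<open>q y p = y p\<close> and \<open>q y p = q y\<close>. The first says that \<open>y\<close> carries the right ideal of
  \<open>p\<close> into that of \<open>q\<close>, and it suffices to check this on the generator \<open>b\<close>; the second is the
  left-right dual, checked on the generator \<open>c'\<close>.
\<close>

text \<open>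
  Such an element is automatically idempotent: \<open>p = b t\<close> and \<open>p b = b\<close> give \<open>p p = p\<close>.
\<close>
definition ideal_idempotent :: "'a::semigroup_mult \<Rightarrow> 'a \<Rightarrow> 'a \<Rightarrow> bool" where
  "ideal_idempotent p b c \<longleftrightarrow>
     p * b = b \<and> c * p = c \<and> p \<in> right_mults b \<and> p \<in> left_mults c"

text \<open>
  The membership \<open>x \<in> b S x\<close> gives \<open>a x \<in> a b S\<close>, and \<open>x \<in> x S c\<close> gives \<open>a x \<in> S c\<close>; multiplying
  \<open>x a b = b\<close> by \<open>a\<close> on the left shows that \<open>a x\<close> fixes \<open>a b\<close>. The lemma for \<open>x a\<close> is the mirror
  image.
\<close>
lemma ideal_idempotent_mult_inverse:
  assumes "is_bc_inverse a b c x"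
  shows "ideal_idempotent (a * x) (a * b) c"
  using assms
  unfolding ideal_idempotent_def is_bc_inverse_def right_mults_def left_mults_def
  by (smt (verit, ccfv_threshold) mem_Collect_eq mult.assoc)

lemma ideal_idempotent_inverse_mult:
  assumes "is_bc_inverse a b c x"
  shows "ideal_idempotent (x * a) b (c * a)"
  using assms
  unfolding ideal_idempotent_def is_bc_inverse_def right_mults_def left_mults_def
  by (smt (verit, ccfv_threshold) mem_Collect_eq mult.assoc)

text \<open>
  This keeps the cofactors found in \<open>intertwines_iff\<close> inside \<open>S\<close>, although \<open>y\<close> itself may be the
  adjoined identity.
\<close>
lemma mult_emb_in_range: "y * emb s \<in> range emb"
proof (cases "y \<in> range emb")
  case True
  then show ?thesis by (metis emb_mult rangeE rangeI)
next
  case False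
  then have "y = 1" by (auto simp: range_emb split: if_splits)
  then show ?thesis by simp
qed

lemma emb_right_mults_iff:
  "z \<in> emb ` right_mults u \<longleftrightarrow> (\<exists>s. z = emb u * emb s)"
  by (auto simp: right_mults_def image_def simp flip: emb_mult)

lemma emb_left_mults_iff:
  "z \<in> emb ` left_mults u \<longleftrightarrow> (\<exists>s. z = emb s * emb u)"
  by (auto simp: left_mults_def image_def simp flip: emb_mult)

text \<open>
  Forwards, \<open>y b = y p b = q y b\<close> lies in the right ideal of \<open>q\<close>, which is that of \<open>b'\<close>.
  Backwards, \<open>q\<close> fixes \<open>y b\<close> and hence \<open>y p\<close>, since \<open>p\<close> is a right multiple of \<open>b\<close>. The condition
  on \<open>c' y\<close> is handled dually, so that \<open>y p = q y p = q y\<close>.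
\<close>
lemma intertwines_iff:
  fixes y :: "'a::semigroup_mult monoid1"
  assumes p: "ideal_idempotent p b c" and q: "ideal_idempotent q b' c'"
  shows "y * emb p = emb q * y \<longleftrightarrow>
    y * emb b \<in> emb ` right_mults b' \<and> emb c' * y \<in> emb ` left_mults c"
proof -
  have fix_p: "emb p * emb b = emb b" "emb c * emb p = emb c"
    and fix_q: "emb q * emb b' = emb b'" "emb c' * emb q = emb c'"
    using p q by (simp_all add: ideal_idempotent_def flip: emb_mult)
  obtain t s where p_mult: "emb p = emb b * emb t" "emb p = emb s * emb c"
    using p by (auto simp: ideal_idempotent_def right_mults_def left_mults_def) (metis emb_mult)
  obtain t' s' where q_mult: "emb q = emb b' * emb t'" "emb q = emb s' * emb c'"
    using q by (auto simp: ideal_idempotent_def right_mults_def left_mults_def) (metis emb_mult)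
  show ?thesis
  proof (intro iffI conjI)
    assume eq: "y * emb p = emb q * y"
    have "y * emb b = emb q * y * emb b"
      by (metis eq fix_p(1) mult.assoc)
    also have "\<dots> = emb b' * (emb t' * (y * emb b))"
      by (simp add: q_mult(1) mult.assoc)
    finally show "y * emb b \<in> emb ` right_mults b'"
      by (metis emb_right_mults_iff emb_mult mult_emb_in_range imageE)
    have "emb c' * y = emb c' * (y * emb p)"
      by (metis eq fix_q(2) mult.assoc)
    also have "\<dots> = (emb c' * y) * emb s * emb c"
      by (simp add: p_mult(2) mult.assoc)
    finally show "emb c' * y \<in> emb ` left_mults c"
      by (metis emb_left_mults_iff mult_emb_in_range imageE)
  next
    assume "y * emb b \<in> emb ` right_mults b' \<and> emb c' * y \<in> emb ` left_mults c"
    then obtain u v where u: "y * emb b = emb b' * emb u" and v: "emb c' * y = emb v * emb c"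
      by (auto simp: emb_right_mults_iff emb_left_mults_iff)
    have "emb q * (y * emb b) = y * emb b"
      by (metis u fix_q(1) mult.assoc)
    then have "emb q * y * emb p = y * emb p"
      by (metis p_mult(1) mult.assoc)
    moreover have "emb c' * y * emb p = emb c' * y"
      by (metis v fix_p(2) mult.assoc)
    then have "emb q * y * emb p = emb q * y"
      by (metis q_mult(2) mult.assoc)
    ultimately show "y * emb p = emb q * y" by simp
  qed
qed

theorem theorem3p10:
  fixes a\<^sub>1 b\<^sub>1 c\<^sub>1 x\<^sub>1 a\<^sub>2 b\<^sub>2 c\<^sub>2 x\<^sub>2 :: "'a::semigroup_mult"
    and y :: "'a monoid1"
  assumes "is_bc_inverse a\<^sub>1 b\<^sub>1 c\<^sub>1 x\<^sub>1"
    and "is_bc_inverse a\<^sub>2 b\<^sub>2 c\<^sub>2 x\<^sub>2"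
  shows
    "(y * emb a\<^sub>1 * emb x\<^sub>1 = emb a\<^sub>2 * emb x\<^sub>2 * y \<longleftrightarrow>
        y * emb a\<^sub>1 * emb b\<^sub>1 \<in> emb ` right_mults (a\<^sub>2 * b\<^sub>2) \<and>
        emb c\<^sub>2 * y \<in> emb ` left_mults c\<^sub>1)
     \<and> (y * emb x\<^sub>1 * emb a\<^sub>1 = emb x\<^sub>2 * emb a\<^sub>2 * y \<longleftrightarrow>
        y * emb b\<^sub>1 \<in> emb ` right_mults b\<^sub>2 \<and>
        emb c\<^sub>2 * emb a\<^sub>2 * y \<in> emb ` left_mults (c\<^sub>1 * a\<^sub>1))
     \<and> (y * emb a\<^sub>1 * emb x\<^sub>1 = emb x\<^sub>2 * emb a\<^sub>2 * y \<longleftrightarrow>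
        y * emb a\<^sub>1 * emb b\<^sub>1 \<in> emb ` right_mults b\<^sub>2 \<and>
        emb c\<^sub>2 * emb a\<^sub>2 * y \<in> emb ` left_mults c\<^sub>1)
     \<and> (y * emb x\<^sub>1 * emb a\<^sub>1 = emb a\<^sub>2 * emb x\<^sub>2 * y \<longleftrightarrow>
        y * emb b\<^sub>1 \<in> emb ` right_mults (a\<^sub>2 * b\<^sub>2) \<and>
        emb c\<^sub>2 * y \<in> emb ` left_mults (c\<^sub>1 * a\<^sub>1))"
proof -
  note ax\<^sub>1 = ideal_idempotent_mult_inverse[OF assms(1)]
  note ax\<^sub>2 = ideal_idempotent_mult_inverse[OF assms(2)]
  note xa\<^sub>1 = ideal_idempotent_inverse_mult[OF assms(1)]
  note xa\<^sub>2 = ideal_idempotent_inverse_mult[OF assms(2)]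
  show ?thesis
    using intertwines_iff[OF ax\<^sub>1 ax\<^sub>2, of y] intertwines_iff[OF xa\<^sub>1 xa\<^sub>2, of y]
      intertwines_iff[OF ax\<^sub>1 xa\<^sub>2, of y] intertwines_iff[OF xa\<^sub>1 ax\<^sub>2, of y]
    by (simp only: emb_mult mult.assoc)
qed

end
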